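(* Let $L>1$ be a constant such that the following holds for all $k\in\mathbb{N}$ and all finite sets $X$: whenever a function $g_k\colon \binom{X}{k}\to[0,1]$ satisfies $w(g_k,p)\le 1$ for some $p\in[0,1]$, there exists a set $G_k\subseteq 2^X\setminus\{\emptyset\}$ with $\langle g_k\rangle\subseteq\langle G_k\rangle$ and $w\left(G_k,\frac{p}{L}\right)\le 1$. Then the following is true for any finite set $X$ and any $p\in[0,1]$: if a function $g\colon 2^X\to[0,1]$ with $g(\emptyset)=0$ satisfies $w(g,p)=1$, then there exists a set $G\subseteq 2^X\setminus\{\emptyset\}$ with $\langle g\rangle\subseteq\langle G\rangle$ and $w\left(G,\frac{p}{4L}\right)\le 1$.
   Context: $\mathbb{N}=\{1,2,\dots\}$. For a finite set $X$, $2^X$ is its power set and $\binom{X}{k}$ is the set of $k$-element subsets of $X$. For $p\in[0,1]$, $G\subseteq 2^X$ and $g\colon 2^X\to[0,\infty)$ define the weights $$w(G,p):=\sum_{T\in G}p^{|T|},\qquad w(g,p):=\sum_{T\in 2^X}g(T)\,p^{|T|},$$ and the families $$\langle G\rangle:=\{S\in 2^X : \text{there is } T\in G \text{ with } T\subseteq S\},\qquad \langle g\rangle:=\Big\{S\in 2^X : \sum_{T\subseteq S}g(T)\ge 1\Big\}.$$ A function defined only on $\binom{X}{k}$ is regarded as a function on $2^X$ by setting it to $0$ outside $\binom{X}{k}$. *)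

theory Defs
  imports Complex_Main "HOL-Library.Ramsey"
begin

definition fam_weight :: "'a set set \<Rightarrow> real \<Rightarrow> real" where
  "fam_weight G p = (\<Sum>T\<in>G. p ^ card T)"

(* The ground set X is an explicit argument below because a function on the
   power set of X is represented by a total function on sets, whose values
   outside Pow X are to be ignored. *)
definition fun_weight :: "'a set \<Rightarrow> ('a set \<Rightarrow> real) \<Rightarrow> real \<Rightarrow> real" where
  "fun_weight X g p = (\<Sum>T\<in>Pow X. g T * p ^ card T)"

definition fam_up :: "'a set \<Rightarrow> 'a set set \<Rightarrow> 'a set set" where
  "fam_up X G = {S \<in> Pow X. \<exists>T\<in>G. T \<subseteq> S}"

definition fun_up :: "'a set \<Rightarrow> ('a set \<Rightarrow> real) \<Rightarrow> 'a set set" where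
  "fun_up X g = {S \<in> Pow X. (\<Sum>T\<in>Pow S. g T) \<ge> 1}"

definition zero_ext :: "'a set \<Rightarrow> nat \<Rightarrow> ('a set \<Rightarrow> real) \<Rightarrow> 'a set \<Rightarrow> real" where
  "zero_ext X k g = (\<lambda>T. if T \<in> nsets X k then g T else 0)"

(* The property assumed of the constant L, for all finite sets.  Ranging over
   the finite sets of natural numbers loses no generality: every finite set is
   in bijection with one of them, and all notions involved are invariant under
   bijections.  Fixing the element type of the theorem's own ground set instead
   would restrict the property when that type is finite. *)
definition uniform_property :: "real \<Rightarrow> bool" where
  "uniform_property L \<longleftrightarrow>
    (\<forall>k\<ge>1. \<forall>X :: nat set. finite X \<longrightarrow>
      (\<forall>g \<in> nsets X k \<rightarrow> {0..1}. \<forall>p\<in>{0..1}.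
        fun_weight X (zero_ext X k g) p \<le> 1 \<longrightarrow>
        (\<exists>G \<subseteq> Pow X - {{}}.
          fun_up X (zero_ext X k g) \<subseteq> fam_up X G \<and> fam_weight G (p / L) \<le> 1)))"

end

theory Submission
  imports Defs
begin

text \<open>
  Cut \<open>g\<close> into its uniform layers.  If \<open>S \<in> fun_up X g\<close>, then the mass of \<open>g\<close> below \<open>S\<close>, being at
  least \<open>1 > \<Sum>k=1..n. 2\<^sup>-\<^sup>k\<close>, puts at least \<open>2\<^sup>-\<^sup>k\<close> on the \<open>k\<close>-sets for some \<open>k \<ge> 1\<close>; hence \<open>S\<close> lies
  in the up-set of the \<open>k\<close>-uniform function \<open>h\<^sub>k = min 1 (2\<^sup>k g)\<close> on \<open>k\<close>-sets.  It remains to cover the up-sets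
  of all the \<open>h\<^sub>k\<close> at once, and for this it suffices that the \<open>k\<close>-th cover has weight at most
  \<open>2\<^sup>-\<^sup>k\<close>, whereas the uniform property only promises weight at most \<open>1\<close>.

  The missing factor comes from taking disjoint copies.  Put \<open>r\<close> disjoint copies of \<open>h\<^sub>k\<close> side by
  side.  A cover for this larger function contains a cover for every copy, and these \<open>r\<close> covers are
  disjoint because they consist of nonempty sets living on disjoint ground sets.  So the cheapest
  of them has weight at most \<open>1/r\<close>.  The price is that the weight of the function grows by the
  factor \<open>r\<close>.  With \<open>r = 2\<^sup>k\<close>, the copies and the scaling in \<open>h\<^sub>k\<close> together cost \<open>4\<^sup>k\<close>, which is exactly
  what a \<open>k\<close>-uniform function gains when \<open>p\<close> is replaced by \<open>p/4\<close>.
\<close>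

section \<open>Uniform functions\<close>

lemma sum_Pow_zero_ext:
  assumes "finite X" "S \<subseteq> X"
  shows "(\<Sum>T\<in>Pow S. zero_ext X k g T * c T) = (\<Sum>T\<in>nsets S k. g T * c T)"
proof (rule sum.mono_neutral_cong_right)
  show "finite (Pow S)"
    using assms finite_subset by auto
qed (use assms in \<open>auto simp: zero_ext_def nsets_def\<close>)

lemma fun_weight_zero_ext:
  assumes "finite X"
  shows "fun_weight X (zero_ext X k g) p = (\<Sum>T\<in>nsets X k. g T * p ^ k)"
  unfolding fun_weight_def sum_Pow_zero_ext[OF assms order_refl]
  by (rule sum.cong) (auto simp: nsets_def)

lemma fun_up_zero_ext:
  assumes "finite X"
  shows "S \<in> fun_up X (zero_ext X k g) \<longleftrightarrow> S \<subseteq> X \<and> 1 \<le> (\<Sum>T\<in>nsets S k. g T)"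
  using sum_Pow_zero_ext[OF assms, of S k g "\<lambda>_. 1"] by (auto simp: fun_up_def)

lemma nsets_image_inj:
  assumes "inj_on f S"
  shows "nsets (f ` S) k = (`) f ` nsets S k"
proof -
  have "card (f ` U) = card U" if "U \<subseteq> S" for U
    using assms that by (metis card_image inj_on_subset)
  moreover have "finite (f ` U) \<longleftrightarrow> finite U" if "U \<subseteq> S" for U
    using assms that by (meson finite_image_iff inj_on_subset)
  ultimately have "f ` U \<in> nsets (f ` S) k \<longleftrightarrow> U \<in> nsets S k" if "U \<subseteq> S" for U
    using that by (auto simp: nsets_def)
  then show ?thesis
    by (auto simp: nsets_def elim!: subset_imageE)
qed

lemma sum_nsets_image:
  assumes "inj_on f S"
  shows "(\<Sum>T\<in>nsets (f ` S) k. g T) = (\<Sum>U\<in>nsets S k. g (f ` U))"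
proof -
  have "inj_on ((`) f) (nsets S k)"
    by (rule inj_on_subset[OF inj_on_image_Pow[OF assms]]) (auto simp: nsets_def)
  then show ?thesis
    by (simp add: nsets_image_inj[OF assms] sum.reindex)
qed

section \<open>Disjoint copies\<close>

text \<open>
  The disjoint-copies argument: any slack by a factor \<open>r\<close> in the weight of a uniform function is
  passed on to the weight of its cover.  Since the copies are placed inside the natural numbers,
  this also carries the uniform property over to ground sets of an arbitrary type.
\<close>

lemma uniform_cover_of_slack:
  fixes X :: "'a set" and h :: "'a set \<Rightarrow> real"
  assumes L: "L > 0" "uniform_property L" and X: "finite X" and k: "k \<ge> 1" and r: "r \<ge> (1::nat)"
    and p: "p \<in> {0..1}" and h: "h \<in> nsets X k \<rightarrow> {0..1}"
    and w: "r * fun_weight X (zero_ext X k h) p \<le> 1"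
  shows "\<exists>G \<subseteq> Pow X - {{}}. fun_up X (zero_ext X k h) \<subseteq> fam_up X G \<and> fam_weight G (p / L) \<le> 1 / r"
proof -
  obtain f :: "'a \<Rightarrow> nat" where f: "inj_on f X"
    using finite_imp_inj_to_nat_seg[OF X] by metis
  define \<phi> where "\<phi> i x = f x * r + i" for i x
  have \<phi>_eqD: "i = j \<and> x = y" if "\<phi> i x = \<phi> j y" "i < r" "j < r" "x \<in> X" "y \<in> X" for i j x y
  proof -
    have "i = j"
      using arg_cong[OF that(1), of "\<lambda>n. n mod r"] that by (simp add: \<phi>_def)
    then show ?thesis
      using that f by (auto simp: \<phi>_def inj_on_def)
  qed
  have inj: "inj_on (\<phi> i) X" if "i < r" for i
    using \<phi>_eqD that by (auto simp: inj_on_def)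
  define \<pi> where "\<pi> n = inv_into X f (n div r)" for n
  have \<pi>: "\<pi> ` \<phi> i ` U = U" if "i < r" "U \<subseteq> X" for i U
  proof -
    have "\<pi> (\<phi> i x) = x" if "x \<in> U" for x
      using inv_into_f_f[OF f, of x] that \<open>i < r\<close> \<open>U \<subseteq> X\<close> by (simp add: \<phi>_def \<pi>_def subsetD)
    then show ?thesis
      by (simp add: image_image)
  qed
  define Y where "Y = (\<Union>i<r. \<phi> i ` X)"
  have Y: "finite Y"
    using X by (simp add: Y_def)
  define h' where "h' T = (if \<exists>i<r. T \<subseteq> \<phi> i ` X then h (\<pi> ` T) else 0)" for T
  have h'_copy: "h' (\<phi> i ` U) = h U" if "i < r" "U \<subseteq> X" for i U
    using that by (auto simp: h'_def \<pi>)
  have h'_cases: "h' T = 0 \<or> (\<exists>i<r. \<exists>U\<in>nsets X k. T = \<phi> i ` U \<and> h' T = h U)"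
    if T: "T \<in> nsets Y k" for T
  proof (cases "\<exists>i<r. T \<subseteq> \<phi> i ` X")
    case True
    then obtain i where i: "i < r" "T \<subseteq> \<phi> i ` X"
      by blast
    then have "T \<in> nsets (\<phi> i ` X) k"
      using T by (auto simp: nsets_def)
    then obtain U where "U \<in> nsets X k" "T = \<phi> i ` U"
      using nsets_image_inj[OF inj[OF i(1)]] by blast
    moreover from this have "h' T = h U"
      using h'_copy[OF i(1)] by (auto simp: nsets_def)
    ultimately show ?thesis
      using i by blast
  qed (auto simp: h'_def)
  have h': "h' \<in> nsets Y k \<rightarrow> {0..1}"
  proof
    fix T assume "T \<in> nsets Y k"
    from h'_cases[OF this] show "h' T \<in> {0..1}"
      using h by auto
  qed
  have "fun_weight Y (zero_ext Y k h') p \<le> 1"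
  proof -
    let ?I = "{..<r} \<times> nsets X k"
    let ?copy = "\<lambda>(i, U). \<phi> i ` U"
    have fin: "finite ?I"
      using X by (simp add: finite_imp_finite_nsets)
    have copy_nsets: "\<phi> i ` U \<in> nsets Y k" if "i < r" "U \<in> nsets X k" for i U
    proof -
      have "\<phi> i ` U \<in> nsets (\<phi> i ` X) k"
        using that by (simp add: nsets_image_inj inj)
      then show ?thesis
        using that(1) unfolding nsets_def Y_def by blast
    qed
    have "fun_weight Y (zero_ext Y k h') p = (\<Sum>T\<in>nsets Y k. h' T * p ^ k)"
      by (rule fun_weight_zero_ext[OF Y])
    also have "\<dots> = (\<Sum>T\<in>?copy ` ?I. h' T * p ^ k)"
    proof (rule sum.mono_neutral_right)
      show "finite (nsets Y k)"
        using Y by (simp add: finite_imp_finite_nsets)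
      show "?copy ` ?I \<subseteq> nsets Y k"
        using copy_nsets by auto
      show "\<forall>T\<in>nsets Y k - ?copy ` ?I. h' T * p ^ k = 0"
        using h'_cases by fastforce
    qed
    also have "\<dots> \<le> (\<Sum>z\<in>?I. ((\<lambda>T. h' T * p ^ k) \<circ> ?copy) z)"
    proof (rule sum_image_le[OF fin])
      fix z assume "z \<in> ?I"
      then have "h' (?copy z) \<in> {0..1}"
        using h' copy_nsets by (auto simp: Pi_iff)
      then show "0 \<le> h' (?copy z) * p ^ k"
        using p by simp
    qed
    also have "\<dots> = (\<Sum>i<r. \<Sum>U\<in>nsets X k. h' (\<phi> i ` U) * p ^ k)"
      by (simp add: sum.cartesian_product case_prod_unfold)
    also have "\<dots> = (\<Sum>i<r. \<Sum>U\<in>nsets X k. h U * p ^ k)"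
      by (intro sum.cong refl) (auto simp: h'_copy nsets_def)
    also have "\<dots> = r * fun_weight X (zero_ext X k h) p"
      by (simp add: fun_weight_zero_ext[OF X])
    finally show ?thesis
      using w by simp
  qed
  then obtain G' where G': "G' \<subseteq> Pow Y - {{}}"
    and cover: "fun_up Y (zero_ext Y k h') \<subseteq> fam_up Y G'" and wG': "fam_weight G' (p / L) \<le> 1"
    using L(2) k Y h' p unfolding uniform_property_def by meson
  have finG': "finite G'"
    using G' Y by (meson finite_Diff finite_Pow_iff finite_subset)

  \<comment> \<open>The part of the cover \<open>G'\<close> that lives on the \<open>i\<close>-th copy, pulled back to \<open>X\<close>.\<close>
  define G where "G i = {U \<in> Pow X. \<phi> i ` U \<in> G'}" for i
  have finG: "finite (G i)" for i
    using X by (simp add: G_def)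
  have G_sub: "G i \<subseteq> Pow X - {{}}" for i
    using G' by (auto simp: G_def)
  have G_cover: "fun_up X (zero_ext X k h) \<subseteq> fam_up X (G i)" if i: "i < r" for i
  proof
    fix S assume "S \<in> fun_up X (zero_ext X k h)"
    then have S: "S \<subseteq> X" "1 \<le> (\<Sum>T\<in>nsets S k. h T)"
      by (simp_all add: fun_up_zero_ext[OF X])
    have "(\<Sum>T\<in>nsets (\<phi> i ` S) k. h' T) = (\<Sum>U\<in>nsets S k. h' (\<phi> i ` U))"
      using inj[OF i] S(1) inj_on_subset by (intro sum_nsets_image) blast
    also have "\<dots> = (\<Sum>U\<in>nsets S k. h U)"
      using S(1) i by (intro sum.cong refl h'_copy) (auto simp: nsets_def)
    finally have "1 \<le> (\<Sum>T\<in>nsets (\<phi> i ` S) k. h' T)"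
      using S(2) by simp
    moreover have "\<phi> i ` S \<subseteq> Y"
      using S(1) i by (auto simp: Y_def)
    ultimately have "\<phi> i ` S \<in> fun_up Y (zero_ext Y k h')"
      by (simp add: fun_up_zero_ext[OF Y])
    then obtain A where "A \<in> G'" "A \<subseteq> \<phi> i ` S"
      using cover by (auto simp: fam_up_def)
    then obtain U where "U \<subseteq> S" "\<phi> i ` U \<in> G'"
      by (metis subset_image_iff)
    then show "S \<in> fam_up X (G i)"
      using S(1) by (auto simp: fam_up_def G_def)
  qed
  have q: "p / L \<ge> 0"
    using p L by simp
  have total: "(\<Sum>i<r. fam_weight (G i) (p / L)) \<le> 1"
  proof -
    let ?copy = "\<lambda>(i, U). \<phi> i ` U"
    let ?I = "Sigma {..<r} G"
    \<comment> \<open>Nonemptiness of the sets is what lets them determine the copy on which they live.\<close>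
    have inj_copy: "inj_on ?copy ?I"
    proof (rule inj_onI, clarsimp)
      fix i U j V
      assume *: "i < r" "j < r" "U \<in> G i" "V \<in> G j" "\<phi> i ` U = \<phi> j ` V"
      have UV: "U \<subseteq> X" "V \<subseteq> X" "U \<noteq> {}"
        using * G_sub by blast+
      then obtain x where x: "x \<in> U"
        by blast
      then obtain y where y: "y \<in> V" "\<phi> i x = \<phi> j y"
        using *(5) by blast
      then have "i = j"
        using \<phi>_eqD[OF y(2)] * UV x by blast
      then show "i = j \<and> U = V"
        using * UV \<pi> by metis
    qed
    have "(\<Sum>i<r. fam_weight (G i) (p / L)) = (\<Sum>(i, U)\<in>?I. (p / L) ^ card U)"
      unfolding fam_weight_def by (rule sum.Sigma) (simp_all add: finG)
    also have "\<dots> = (\<Sum>z\<in>?I. (p / L) ^ card (?copy z))"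
    proof (rule sum.cong[OF refl], clarsimp)
      fix i U assume "i < r" "U \<in> G i"
      then have "card (\<phi> i ` U) = card U"
        using inj inj_on_subset G_sub by (metis (no_types, lifting) DiffD1 PowD card_image subsetD)
      then show "(p / L) ^ card U = (p / L) ^ card (\<phi> i ` U)"
        by simp
    qed
    also have "\<dots> = (\<Sum>A\<in>?copy ` ?I. (p / L) ^ card A)"
      by (simp add: sum.reindex[OF inj_copy])
    also have "\<dots> \<le> fam_weight G' (p / L)"
      unfolding fam_weight_def
      using finG' q by (intro sum_mono2) (auto simp: G_def)
    finally show ?thesis
      using wG' by simp
  qed
  have "\<exists>i<r. fam_weight (G i) (p / L) \<le> 1 / r"
  proof (rule ccontr)
    assume "\<not> ?thesis"
    then have "(\<Sum>i<r. 1 / real r) < (\<Sum>i<r. fam_weight (G i) (p / L))"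
      using r by (intro sum_strict_mono) (auto simp: not_le lessThan_empty_iff)
    then show False
      using total r by simp
  qed
  then show ?thesis
    using G_sub G_cover by blast
qed

section \<open>Uniform layers\<close>

text \<open>
  The scaled layers are truncated at \<open>1\<close> only to keep their values in \<open>{0..1}\<close>.  This loses nothing:
  an entry that is cut off already contributes \<open>1\<close> on its own.
\<close>

lemma sum_min_one_ge_one:
  fixes g :: "'b \<Rightarrow> real"
  assumes F: "finite F" and g: "\<And>x. x \<in> F \<Longrightarrow> 0 \<le> g x" and ge: "1 \<le> (\<Sum>x\<in>F. g x)"
  shows "1 \<le> (\<Sum>x\<in>F. min 1 (g x))"
proof (cases "\<exists>x\<in>F. 1 \<le> g x")
  case True
  then obtain x where x: "x \<in> F" "1 \<le> g x"
    by blast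
  then have "min 1 (g x) \<le> (\<Sum>x\<in>F. min 1 (g x))"
    using F g by (intro member_le_sum) auto
  then show ?thesis
    using x by simp
next
  case False
  then have "(\<Sum>x\<in>F. min 1 (g x)) = (\<Sum>x\<in>F. g x)"
    by (intro sum.cong) auto
  then show ?thesis
    using ge by simp
qed

lemma sum_half_powers: "(\<Sum>k=1..n. 1 / 2 ^ k) = 1 - 1 / (2::real) ^ n"
  by (induction n) (auto simp: field_simps)

lemma sum_Pow_layers:
  assumes "finite S" "card S \<le> n" "g {} = (0::real)"
  shows "(\<Sum>T\<in>Pow S. g T) = (\<Sum>k=1..n. \<Sum>T\<in>nsets S k. g T)"
proof -
  have "(\<Sum>T\<in>Pow S. g T) = (\<Sum>T\<in>Pow S - {{}}. g T)"
    using assms by (intro sum.mono_neutral_right) auto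
  also have "Pow S - {{}} = (\<Union>k\<in>{1..n}. nsets S k)"
  proof -
    have "finite T \<and> card T \<le> n" if "T \<subseteq> S" for T
    proof -
      have "finite T"
        using that assms finite_subset by blast
      moreover have "card T \<le> n"
        using that assms card_mono order_trans by blast
      ultimately show ?thesis
        by blast
    qed
    then show ?thesis
      by (auto simp: nsets_def Suc_le_eq card_gt_0_iff)
  qed
  also have "(\<Sum>T\<in>(\<Union>k\<in>{1..n}. nsets S k). g T) = (\<Sum>k=1..n. \<Sum>T\<in>nsets S k. g T)"
    using assms(1)
    by (intro sum.UNION_disjoint) (auto simp: finite_imp_finite_nsets, auto simp: nsets_def)
  finally show ?thesis .
qed

lemma fam_weight_UN_le:
  assumes "finite K" "\<And>k. k \<in> K \<Longrightarrow> finite (G k)" "q \<ge> 0"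
  shows "fam_weight (\<Union>k\<in>K. G k) q \<le> (\<Sum>k\<in>K. fam_weight (G k) q)"
proof -
  have "fam_weight (\<Union>k\<in>K. G k) q = (\<Sum>T\<in>snd ` Sigma K G. q ^ card T)"
    unfolding fam_weight_def by (rule sum.cong) force+
  also have "\<dots> \<le> (\<Sum>z\<in>Sigma K G. ((\<lambda>T. q ^ card T) \<circ> snd) z)"
    using assms by (intro sum_image_le) auto
  also have "\<dots> = (\<Sum>k\<in>K. fam_weight (G k) q)"
    using assms by (simp add: fam_weight_def sum.Sigma case_prod_unfold)
  finally show ?thesis .
qed

section \<open>Reduction to the uniform case\<close>

theorem theorem8:
  fixes L p :: real and X :: "'a set" and g :: "'a set \<Rightarrow> real"
  assumes "L > 1"
    and "uniform_property L"
    and "finite X"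
    and "p \<in> {0..1}"
    and "g \<in> Pow X \<rightarrow> {0..1}"
    and "g {} = 0"
    and "fun_weight X g p = 1"
  shows "\<exists>G \<subseteq> Pow X - {{}}.
           fun_up X g \<subseteq> fam_up X G \<and> fam_weight G (p / (4 * L)) \<le> 1"
proof -
  define h where "h k T = min 1 (2 ^ k * g T)" for k :: nat and T
  define n where "n = card X"
  have g_nonneg: "0 \<le> g T" if "T \<subseteq> X" for T
    using assms(5) that by auto
  have h: "h k \<in> nsets X k \<rightarrow> {0..1}" for k
    using g_nonneg by (auto simp: h_def nsets_def)

  have h_weight: "(2 ^ k :: nat) * fun_weight X (zero_ext X k (h k)) (p / 4) \<le> 1" for k
  proof -
    have "(2 ^ k :: nat) * fun_weight X (zero_ext X k (h k)) (p / 4)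
        = (\<Sum>T\<in>nsets X k. 2 ^ k * (h k T * (p / 4) ^ k))"
      by (simp add: fun_weight_zero_ext[OF assms(3)] sum_distrib_left)
    also have "\<dots> \<le> (\<Sum>T\<in>nsets X k. g T * p ^ card T)"
    proof (rule sum_mono)
      fix T assume T: "T \<in> nsets X k"
      have "2 ^ k * (h k T * (p / 4) ^ k) \<le> 2 ^ k * ((2 ^ k * g T) * (p / 4) ^ k)"
        using assms(4) by (intro mult_left_mono mult_right_mono) (auto simp: h_def)
      also have "\<dots> = (2 * 2 * (p / 4)) ^ k * g T"
        by (simp only: power_mult_distrib mult_ac)
      also have "\<dots> = g T * p ^ card T"
        using T by (simp add: nsets_def mult.commute)
      finally show "2 ^ k * (h k T * (p / 4) ^ k) \<le> g T * p ^ card T" .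
    qed
    also have "\<dots> \<le> fun_weight X g p"
      unfolding fun_weight_def
      using assms(3,4) g_nonneg by (intro sum_mono2) (auto simp: nsets_def)
    finally show ?thesis
      using assms(7) by simp
  qed

  have "\<exists>G \<subseteq> Pow X - {{}}. fun_up X (zero_ext X k (h k)) \<subseteq> fam_up X G
          \<and> fam_weight G (p / (4 * L)) \<le> 1 / 2 ^ k" if "k \<in> {1..n}" for k
    using uniform_cover_of_slack[OF _ assms(2,3) _ _ _ h h_weight, of k] that assms(1,4)
    by (simp add: divide_divide_eq_left)
  then obtain G where G: "\<And>k. k \<in> {1..n} \<Longrightarrow> G k \<subseteq> Pow X - {{}}"
    and cover: "\<And>k. k \<in> {1..n} \<Longrightarrow> fun_up X (zero_ext X k (h k)) \<subseteq> fam_up X (G k)"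
    and wG: "\<And>k. k \<in> {1..n} \<Longrightarrow> fam_weight (G k) (p / (4 * L)) \<le> 1 / 2 ^ k"
    by metis

  have "fun_up X g \<subseteq> fam_up X (\<Union>k\<in>{1..n}. G k)"
  proof
    fix S assume "S \<in> fun_up X g"
    then have S: "S \<subseteq> X" "1 \<le> (\<Sum>T\<in>Pow S. g T)"
      by (auto simp: fun_up_def)
    have finS: "finite S"
      using S(1) assms(3) finite_subset by blast
    have "\<exists>k\<in>{1..n}. 1 / 2 ^ k \<le> (\<Sum>T\<in>nsets S k. g T)"
    proof (rule ccontr)
      assume "\<not> ?thesis"
      then have "(\<Sum>k=1..n. \<Sum>T\<in>nsets S k. g T) \<le> (\<Sum>k=1..n. 1 / 2 ^ k)"
        by (intro sum_mono) (simp add: not_le less_imp_le)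
      also have "\<dots> < 1"
        unfolding sum_half_powers by simp
      finally show False
        using S sum_Pow_layers[of S n g, OF finS _ assms(6)] card_mono[OF assms(3) S(1)]
        by (simp add: n_def)
    qed
    then obtain k where k: "k \<in> {1..n}" "1 / 2 ^ k \<le> (\<Sum>T\<in>nsets S k. g T)"
      by blast
    have "1 \<le> (\<Sum>T\<in>nsets S k. h k T)"
      unfolding h_def
    proof (rule sum_min_one_ge_one)
      show "finite (nsets S k)"
        using finS by (simp add: finite_imp_finite_nsets)
      show "0 \<le> 2 ^ k * g T" if "T \<in> nsets S k" for T
        using that S(1) g_nonneg by (auto simp: nsets_def)
      show "1 \<le> (\<Sum>T\<in>nsets S k. 2 ^ k * g T)"
        unfolding sum_distrib_left[symmetric] using k(2) by (simp add: field_simps)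
    qed
    then have "S \<in> fun_up X (zero_ext X k (h k))"
      using S(1) by (simp add: fun_up_zero_ext[OF assms(3)])
    then have "S \<in> fam_up X (G k)"
      using cover[OF k(1)] by blast
    then show "S \<in> fam_up X (\<Union>k\<in>{1..n}. G k)"
      using k(1) unfolding fam_up_def by blast
  qed
  moreover have "fam_weight (\<Union>k\<in>{1..n}. G k) (p / (4 * L)) \<le> 1"
  proof -
    have "finite (G k)" if "k \<in> {1..n}" for k
      using G[OF that] assms(3) by (meson finite_Diff finite_Pow_iff finite_subset)
    then have "fam_weight (\<Union>k\<in>{1..n}. G k) (p / (4 * L)) \<le> (\<Sum>k=1..n. fam_weight (G k) (p / (4 * L)))"
      using assms(1,4) by (intro fam_weight_UN_le) auto
    also have "\<dots> \<le> (\<Sum>k=1..n. 1 / 2 ^ k)"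
      using wG by (intro sum_mono)
    also have "\<dots> \<le> 1"
      unfolding sum_half_powers by simp
    finally show ?thesis .
  qed
  moreover have "(\<Union>k\<in>{1..n}. G k) \<subseteq> Pow X - {{}}"
    using G by blast
  ultimately show ?thesis
    by blast
qed

end
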